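(* Let $F:\mathcal{A}\to\mathcal{C}$ be a form such that $f.A$ and $B.f$ exist for every $\mathcal{C}$-morphism $f:X\to Y$, $A\in F^{-1}X$, $B\in F^{-1}Y$, and such that each fibre $F^{-1}X$ is a complete lattice. For a topogenous order $\sqsubset$ on $F$ satisfying condition $(TM)$ and a closure operator $C$ on $F$, the assignments $C\mapsto\sqsubset^{C}$ and $\sqsubset\mapsto C^{\sqsubset}$, where $A\sqsubset^{C}_{X}B\Leftrightarrow C_X(A)\leq_X B$ and $C^{\sqsubset}_X(A)=\bigwedge\{B\in F^{-1}X\mid A\sqsubset_X B\}$ for any $X\in\mathcal{C}$ and $A,B\in F^{-1}X$, define order isomorphisms inverse to each other between $\mathrm{MTORD}(F)$ and $\mathrm{Clo}(F)$. Moreover, $C^{\sqsubset}$ is idempotent if and only if $\sqsubset$ is interpolative.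
   Context: A form over a category $\mathcal{C}$ is a functor $F:\mathcal{A}\to\mathcal{C}$ that is faithful and amnestic (an isomorphism $h:A\to B$ in $\mathcal{A}$ with $Fh=1_{FA}$ satisfies $A=B$, $h=1_A$). The fibre $F^{-1}X$ consists of the objects $A$ with $FA=X$ and the morphisms $g$ with $Fg=1_X$. For $f:X\to Y$ in $\mathcal{C}$, $A\in F^{-1}X$, $B\in F^{-1}Y$, write $A\leq_f B$ if there is an $\mathcal{A}$-morphism $\alpha:A\to B$ with $F\alpha=f$; $\leq_X$ (or $\leq$) means $\leq_{1_X}$, a partial order on $F^{-1}X$. The object $f.A\in F^{-1}Y$ is the codomain of a cocartesian lifting of $f$ at $A$: $A\leq_f f.A$, and for all $D\in\mathcal{A}$ and $g:Y\to FD$, $f.A\leq_g D\Leftrightarrow A\leq_{g\circ f}D$. Dually, $B.f\in F^{-1}X$ is the domain of a cartesian lifting of $f$ at $B$: $B.f\leq_f B$, and for all $D\in\mathcal{A}$ and $g:FD\to X$, $D\leq_g B.f\Leftrightarrow D\leq_{f\circ g}B$. A closure operator on $F$ is a family of maps $C_X:F^{-1}X\to F^{-1}X$ ($X\in\mathcal{C}$) with (C1) $A\leq C_X(A)$ for all $A\in F^{-1}X$; (C2) for every $f:X\to Y$ in $\mathcal{C}$, $A\leq_f B\Rightarrow C_X(A)\leq_f C_Y(B)$ for all $A\in F^{-1}X$, $B\in F^{-1}Y$. $\mathrm{Clo}(F)$ is the conglomerate of all closure operators on $F$, ordered by $C\preceq C'$ iff $C_X(A)\leq C'_X(A)$ for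 all $X\in\mathcal{C}$, $A\in F^{-1}X$. $C$ is idempotent if $C_X(C_X(A))=C_X(A)$ for all $X$, $A$. A topogenous order $\sqsubset$ on $F$ is a family of binary relations $\sqsubset_X$ on $F^{-1}X$ ($X\in\mathcal{C}$) with (T1) $A\sqsubset_X B\Rightarrow A\leq_X B$; (T2) $A'\leq_X A\sqsubset_X B\leq_X B'\Rightarrow A'\sqsubset_X B'$; (T3) for every $f:X\to Y$ in $\mathcal{C}$, $f.A\sqsubset_Y B\Rightarrow A\sqsubset_X B.f$ for $A\in F^{-1}X$, $B\in F^{-1}Y$. Topogenous orders are ordered by $\sqsubset\subseteq\sqsubset'$ iff $A\sqsubset_X B\Rightarrow A\sqsubset'_X B$ for all $X\in\mathcal{C}$ and $A,B\in F^{-1}X$. $\sqsubset$ is interpolative if $A\sqsubset_X B$ implies that there is $D\in F^{-1}X$ with $A\sqsubset_X D\sqsubset_X B$. Condition $(TM)$: for $\{B_i\mid i\in I\}\subseteq F^{-1}X$, if $A\sqsubset_X B_i$ for all $i\in I$, then $A\sqsubset_X\bigwedge B_i$ whenever $\bigwedge B_i$ exists. $\mathrm{MTORD}(F)$ is the conglomerate of all topogenous orders on $F$ satisfying $(TM)$, with the order $\subseteq$.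
   Formalization: The order isomorphisms are between Clo(F) and MTORD(F) with its inclusion order reversed: C ≤ C' iff ⊏^{C'} ⊆ ⊏^{C}; with the inclusion order itself the assignments are not order preserving (e.g. the chain 0<1 over the terminal category). *)

theory Defs
  imports "HOL-Algebra.Complete_Lattice" "HOL-Library.FuncSet"
begin

section \<open>Categories and forms\<close>

text \<open>
  Objects and morphisms are elements of arbitrary types, cut down to the sets \<open>Obj\<close> and \<open>Mor\<close>.
  \<open>Comp \<C> g f\<close> is the composite of \<open>f\<close> followed by \<open>g\<close>.
\<close>

record ('o, 'm) cat =
  Obj :: "'o set"
  Mor :: "'m set"
  Dom :: "'m \<Rightarrow> 'o"
  Cod :: "'m \<Rightarrow> 'o"
  Ident :: "'o \<Rightarrow> 'm"
  Comp :: "'m \<Rightarrow> 'm \<Rightarrow> 'm"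

definition hom_set :: "('o, 'm) cat \<Rightarrow> 'o \<Rightarrow> 'o \<Rightarrow> 'm set" where
  "hom_set \<C> X Y = {f \<in> Mor \<C>. Dom \<C> f = X \<and> Cod \<C> f = Y}"

locale category =
  fixes \<C> :: "('o, 'm) cat"
  assumes Dom_in_Obj: "f \<in> Mor \<C> \<Longrightarrow> Dom \<C> f \<in> Obj \<C>"
    and Cod_in_Obj: "f \<in> Mor \<C> \<Longrightarrow> Cod \<C> f \<in> Obj \<C>"
    and Ident_hom: "X \<in> Obj \<C> \<Longrightarrow> Ident \<C> X \<in> hom_set \<C> X X"
    and Comp_hom: "f \<in> hom_set \<C> X Y \<Longrightarrow> g \<in> hom_set \<C> Y Z \<Longrightarrow> Comp \<C> g f \<in> hom_set \<C> X Z"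
    and Comp_Ident_right: "f \<in> hom_set \<C> X Y \<Longrightarrow> Comp \<C> f (Ident \<C> X) = f"
    and Comp_Ident_left: "f \<in> hom_set \<C> X Y \<Longrightarrow> Comp \<C> (Ident \<C> Y) f = f"
    and Comp_assoc: "f \<in> hom_set \<C> W X \<Longrightarrow> g \<in> hom_set \<C> X Y \<Longrightarrow> h \<in> hom_set \<C> Y Z \<Longrightarrow>
      Comp \<C> h (Comp \<C> g f) = Comp \<C> (Comp \<C> h g) f"

definition isomorphism :: "('o, 'm) cat \<Rightarrow> 'o \<Rightarrow> 'o \<Rightarrow> 'm \<Rightarrow> bool" where
  "isomorphism \<C> X Y h \<longleftrightarrow> h \<in> hom_set \<C> X Y \<and>
     (\<exists>k \<in> hom_set \<C> Y X. Comp \<C> k h = Ident \<C> X \<and> Comp \<C> h k = Ident \<C> Y)"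

record ('a, 'm, 'x, 'n) funct =
  dom_cat :: "('a, 'm) cat"
  cod_cat :: "('x, 'n) cat"
  omap :: "'a \<Rightarrow> 'x"
  mmap :: "'m \<Rightarrow> 'n"

locale is_funct =
  fixes F :: "('a, 'm, 'x, 'n) funct"
  assumes category_dom: "category (dom_cat F)"
    and category_cod: "category (cod_cat F)"
    and omap_Obj: "A \<in> Obj (dom_cat F) \<Longrightarrow> omap F A \<in> Obj (cod_cat F)"
    and mmap_hom: "\<alpha> \<in> hom_set (dom_cat F) A B \<Longrightarrow>
      mmap F \<alpha> \<in> hom_set (cod_cat F) (omap F A) (omap F B)"
    and mmap_Ident: "A \<in> Obj (dom_cat F) \<Longrightarrow>
      mmap F (Ident (dom_cat F) A) = Ident (cod_cat F) (omap F A)"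
    and mmap_Comp: "\<alpha> \<in> hom_set (dom_cat F) A B \<Longrightarrow> \<beta> \<in> hom_set (dom_cat F) B D \<Longrightarrow>
      mmap F (Comp (dom_cat F) \<beta> \<alpha>) = Comp (cod_cat F) (mmap F \<beta>) (mmap F \<alpha>)"

locale form = is_funct F for F :: "('a, 'm, 'x, 'n) funct" +
  assumes faithful: "inj_on (mmap F) (hom_set (dom_cat F) A B)"
    and amnestic: "isomorphism (dom_cat F) A B h \<Longrightarrow>
      mmap F h = Ident (cod_cat F) (omap F A) \<Longrightarrow> A = B \<and> h = Ident (dom_cat F) A"

definition leq_over :: "('a, 'm, 'x, 'n) funct \<Rightarrow> 'n \<Rightarrow> 'a \<Rightarrow> 'a \<Rightarrow> bool" where
  "leq_over F f A B \<longleftrightarrow> (\<exists>\<alpha> \<in> hom_set (dom_cat F) A B. mmap F \<alpha> = f)"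

definition fibre :: "('a, 'm, 'x, 'n) funct \<Rightarrow> 'x \<Rightarrow> 'a gorder" where
  "fibre F X = \<lparr> carrier = {A \<in> Obj (dom_cat F). omap F A = X}, eq = (=),
     le = leq_over F (Ident (cod_cat F) X) \<rparr>"

text \<open>
  The objects \<open>f.A\<close> and \<open>B.f\<close>. Amnesticity makes them unique, but existence is a hypothesis on the
  form: \<open>direct_image\<close> and \<open>inverse_image\<close> are meaningful only when the liftings exist.
\<close>

definition is_direct_image :: "('a, 'm, 'x, 'n) funct \<Rightarrow> 'n \<Rightarrow> 'a \<Rightarrow> 'a \<Rightarrow> bool" where
  "is_direct_image F f A E \<longleftrightarrow> E \<in> carrier (fibre F (Cod (cod_cat F) f)) \<and> leq_over F f A E \<and>
     (\<forall>D \<in> Obj (dom_cat F). \<forall>g \<in> hom_set (cod_cat F) (Cod (cod_cat F) f) (omap F D).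
        leq_over F g E D \<longleftrightarrow> leq_over F (Comp (cod_cat F) g f) A D)"

definition is_inverse_image :: "('a, 'm, 'x, 'n) funct \<Rightarrow> 'a \<Rightarrow> 'n \<Rightarrow> 'a \<Rightarrow> bool" where
  "is_inverse_image F B f E \<longleftrightarrow> E \<in> carrier (fibre F (Dom (cod_cat F) f)) \<and> leq_over F f E B \<and>
     (\<forall>D \<in> Obj (dom_cat F). \<forall>g \<in> hom_set (cod_cat F) (omap F D) (Dom (cod_cat F) f).
        leq_over F g D E \<longleftrightarrow> leq_over F (Comp (cod_cat F) f g) D B)"

definition direct_image :: "('a, 'm, 'x, 'n) funct \<Rightarrow> 'n \<Rightarrow> 'a \<Rightarrow> 'a" where
  "direct_image F f A = (THE E. is_direct_image F f A E)"

definition inverse_image :: "('a, 'm, 'x, 'n) funct \<Rightarrow> 'a \<Rightarrow> 'n \<Rightarrow> 'a" where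
  "inverse_image F B f = (THE E. is_inverse_image F B f E)"

definition has_images :: "('a, 'm, 'x, 'n) funct \<Rightarrow> bool" where
  "has_images F \<longleftrightarrow> (\<forall>X Y. \<forall>f \<in> hom_set (cod_cat F) X Y.
     (\<forall>A \<in> carrier (fibre F X). \<exists>E. is_direct_image F f A E) \<and>
     (\<forall>B \<in> carrier (fibre F Y). \<exists>E. is_inverse_image F B f E))"

section \<open>Closure operators\<close>

text \<open>
  A family of maps on the fibres is a function in the extensional product, so that two families
  agreeing on all objects of the base and all elements of the fibres are equal.
\<close>

definition closure_op :: "('a, 'm, 'x, 'n) funct \<Rightarrow> ('x \<Rightarrow> 'a \<Rightarrow> 'a) \<Rightarrow> bool" where
  "closure_op F C \<longleftrightarrow>
     C \<in> (\<Pi>\<^sub>E X \<in> Obj (cod_cat F). carrier (fibre F X) \<rightarrow>\<^sub>E carrier (fibre F X)) \<and>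
     (\<forall>X \<in> Obj (cod_cat F). \<forall>A \<in> carrier (fibre F X). le (fibre F X) A (C X A)) \<and>
     (\<forall>X Y. \<forall>f \<in> hom_set (cod_cat F) X Y. \<forall>A \<in> carrier (fibre F X). \<forall>B \<in> carrier (fibre F Y).
        leq_over F f A B \<longrightarrow> leq_over F f (C X A) (C Y B))"

definition Clo :: "('a, 'm, 'x, 'n) funct \<Rightarrow> ('x \<Rightarrow> 'a \<Rightarrow> 'a) gorder" where
  "Clo F = \<lparr> carrier = {C. closure_op F C}, eq = (=),
     le = (\<lambda>C C'. \<forall>X \<in> Obj (cod_cat F). \<forall>A \<in> carrier (fibre F X).
             le (fibre F X) (C X A) (C' X A)) \<rparr>"

definition idempotent_op :: "('a, 'm, 'x, 'n) funct \<Rightarrow> ('x \<Rightarrow> 'a \<Rightarrow> 'a) \<Rightarrow> bool" where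
  "idempotent_op F C \<longleftrightarrow> (\<forall>X \<in> Obj (cod_cat F). idempotent (fibre F X) (C X))"

section \<open>Topogenous orders\<close>

text \<open>
  The first two conjuncts say that \<open>R\<close> is a family of relations on the fibres, indexed by the
  objects of the base category; off the objects it is empty, for extensionality.
\<close>

definition topogenous :: "('a, 'm, 'x, 'n) funct \<Rightarrow> ('x \<Rightarrow> 'a rel) \<Rightarrow> bool" where
  "topogenous F R \<longleftrightarrow>
     (\<forall>X \<in> Obj (cod_cat F). R X \<subseteq> carrier (fibre F X) \<times> carrier (fibre F X)) \<and>
     (\<forall>X. X \<notin> Obj (cod_cat F) \<longrightarrow> R X = {}) \<and>
     (\<forall>X \<in> Obj (cod_cat F). \<forall>(A, B) \<in> R X. le (fibre F X) A B) \<and>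
     (\<forall>X \<in> Obj (cod_cat F). \<forall>A' \<in> carrier (fibre F X). \<forall>B' \<in> carrier (fibre F X). \<forall>(A, B) \<in> R X.
        le (fibre F X) A' A \<and> le (fibre F X) B B' \<longrightarrow> (A', B') \<in> R X) \<and>
     (\<forall>X Y. \<forall>f \<in> hom_set (cod_cat F) X Y. \<forall>A \<in> carrier (fibre F X). \<forall>B \<in> carrier (fibre F Y).
        (direct_image F f A, B) \<in> R Y \<longrightarrow> (A, inverse_image F B f) \<in> R X)"

text \<open>
  Condition (TM) ranges over all families, the empty one included: if the fibre over \<open>X\<close> has a
  largest element, every \<open>A\<close> over \<open>X\<close> is related to it.
\<close>

definition TM :: "('a, 'm, 'x, 'n) funct \<Rightarrow> ('x \<Rightarrow> 'a rel) \<Rightarrow> bool" where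
  "TM F R \<longleftrightarrow> (\<forall>X \<in> Obj (cod_cat F). \<forall>A \<in> carrier (fibre F X). \<forall>S \<subseteq> carrier (fibre F X).
     \<forall>M. (\<forall>B \<in> S. (A, B) \<in> R X) \<and> is_glb (fibre F X) M S \<longrightarrow> (A, M) \<in> R X)"

definition MTORD :: "('a, 'm, 'x, 'n) funct \<Rightarrow> ('x \<Rightarrow> 'a rel) gorder" where
  "MTORD F = \<lparr> carrier = {R. topogenous F R \<and> TM F R}, eq = (=),
     le = (\<lambda>R R'. \<forall>X \<in> Obj (cod_cat F). R X \<subseteq> R' X) \<rparr>"

definition interpolative :: "('a, 'm, 'x, 'n) funct \<Rightarrow> ('x \<Rightarrow> 'a rel) \<Rightarrow> bool" where
  "interpolative F R \<longleftrightarrow> (\<forall>X \<in> Obj (cod_cat F). \<forall>(A, B) \<in> R X.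
     \<exists>D \<in> carrier (fibre F X). (A, D) \<in> R X \<and> (D, B) \<in> R X)"

section \<open>The two assignments\<close>

text \<open>
  Both assignments reverse the orders of \<open>Clo\<close> and \<open>MTORD\<close>: the larger \<open>C\<close> is, the fewer pairs satisfy
  \<open>C X A \<le> B\<close>. They are order isomorphisms between \<open>Clo\<close> and the opposite of the inclusion order.
\<close>

definition topo_of_clo :: "('a, 'm, 'x, 'n) funct \<Rightarrow> ('x \<Rightarrow> 'a \<Rightarrow> 'a) \<Rightarrow> 'x \<Rightarrow> 'a rel" where
  "topo_of_clo F C X = {(A, B). X \<in> Obj (cod_cat F) \<and> A \<in> carrier (fibre F X) \<and>
     B \<in> carrier (fibre F X) \<and> le (fibre F X) (C X A) B}"

definition clo_of_topo :: "('a, 'm, 'x, 'n) funct \<Rightarrow> ('x \<Rightarrow> 'a rel) \<Rightarrow> 'x \<Rightarrow> 'a \<Rightarrow> 'a" where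
  "clo_of_topo F R = (\<lambda>X \<in> Obj (cod_cat F). \<lambda>A \<in> carrier (fibre F X).
     \<Sqinter>\<^bsub>fibre F X\<^esub> {B \<in> carrier (fibre F X). (A, B) \<in> R X})"

text \<open>
  \<open>order_emb\<close> is two-sided (it preserves and reflects the order), so this says that \<open>f\<close> and \<open>g\<close>
  are mutually inverse isomorphisms of the partial orders \<open>P\<close> and \<open>Q\<close>.
\<close>

definition inverse_order_isos ::
    "('p, 'u) gorder_scheme \<Rightarrow> ('q, 'v) gorder_scheme \<Rightarrow> ('p \<Rightarrow> 'q) \<Rightarrow> ('q \<Rightarrow> 'p) \<Rightarrow> bool" where
  "inverse_order_isos P Q f g \<longleftrightarrow> partial_order P \<and> partial_order Q \<and>
     f \<in> carrier P \<rightarrow> carrier Q \<and> g \<in> carrier Q \<rightarrow> carrier P \<and>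
     (\<forall>p \<in> carrier P. g (f p) = p) \<and> (\<forall>q \<in> carrier Q. f (g q) = q) \<and>
     order_emb P Q f \<and> order_emb Q P g"

end

theory Submission
  imports Defs
begin

text \<open>
  Fix a topogenous order \<open>\<sqsubset>\<close> and an element \<open>A\<close> of a fibre. Condition (TM) says exactly that
  the up-closed set \<open>{B. A \<sqsubset> B}\<close> is closed under meets, so in a complete lattice it is the principal
  filter generated by its meet \<open>C\<^sup>\<sqsubset> A\<close>. Hence \<open>A \<sqsubset> B\<close> iff \<open>C\<^sup>\<sqsubset> A \<le> B\<close>
  (\<open>related_iff_clo_of_topo_le\<close>), which is one of the two inverse laws. The other one is the
  triviality that \<open>C A\<close> is the meet of the principal filter \<open>{B. C A \<le> B}\<close>. A larger generator gives a
  smaller filter, so the correspondence reverses the order.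

  What remains is that the axioms correspond. Extensivity of \<open>C\<close> is (T1), and functoriality (C2) is
  (T3), since the universal properties turn \<open>A \<le>\<^sub>f B\<close> into \<open>f.A \<le> B\<close> and into \<open>A \<le> B.f\<close>:

  \<^item> if (C2) holds and \<open>C (f.A) \<le> B\<close>, then \<open>A \<le>\<^sub>f f.A\<close> gives \<open>C A \<le>\<^sub>f C (f.A) \<le> B\<close>, that is,
    \<open>C A \<le> B.f\<close>;
  \<^item> if (T3) holds and \<open>A \<le>\<^sub>f B\<close>, then \<open>f.A \<le> B \<sqsubset> C B\<close>, so \<open>A \<sqsubset> (C B).f\<close>, that is,
    \<open>C A \<le>\<^sub>f C B\<close>.

  Finally, the canonical interpolant of \<open>C A \<le> B\<close> is \<open>C A\<close> itself: it works for every such \<open>B\<close>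
  exactly when \<open>C (C A) \<le> C A\<close>, and any interpolant of \<open>A \<sqsubset> C A\<close> forces this inequality, since
  \<open>C A \<le> D\<close> and \<open>C D \<le> C A\<close> give \<open>C (C A) \<le> C D \<le> C A\<close>.
\<close>

section \<open>The relation over a base morphism\<close>

lemma carrier_fibre_iff: "A \<in> carrier (fibre F X) \<longleftrightarrow> A \<in> Obj (dom_cat F) \<and> omap F A = X"
  by (simp add: fibre_def)

lemma le_fibre: "le (fibre F X) A B \<longleftrightarrow> leq_over F (Ident (cod_cat F) X) A B"
  by (simp add: fibre_def)

lemma eq_fibre: "eq (fibre F X) = (=)"
  by (simp add: fibre_def)

context is_funct
begin

lemma leq_over_trans:
  assumes "leq_over F f A B" and "leq_over F g B D"
  shows "leq_over F (Comp (cod_cat F) g f) A D"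
proof -
  interpret dom: category "dom_cat F" by (rule category_dom)
  obtain \<alpha> \<beta> where "\<alpha> \<in> hom_set (dom_cat F) A B" "mmap F \<alpha> = f"
    and "\<beta> \<in> hom_set (dom_cat F) B D" "mmap F \<beta> = g"
    using assms by (auto simp: leq_over_def)
  then show ?thesis
    using dom.Comp_hom mmap_Comp unfolding leq_over_def by blast
qed

lemma leq_over_le_trans:
  assumes "f \<in> hom_set (cod_cat F) X Y" and "leq_over F f A B" and "le (fibre F Y) B B'"
  shows "leq_over F f A B'"
  using leq_over_trans[of f A B "Ident (cod_cat F) Y" B'] assms
    category.Comp_Ident_left[OF category_cod] by (simp add: le_fibre)

end

text \<open>
  The ambient situation of the correspondence. With complete lattices as fibres the antisymmetry of
  the fibre orders identifies any two cocartesian (or cartesian) liftings.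
\<close>

locale complete_form = form F for F :: "('a, 'm, 'x, 'n) funct" +
  assumes images: "has_images F"
    and complete: "X \<in> Obj (cod_cat F) \<Longrightarrow> complete_lattice (fibre F X)"
begin

sublocale base: category "cod_cat F"
  by (rule category_cod)

lemma hom_set_objects:
  assumes "f \<in> hom_set (cod_cat F) X Y"
  shows "X \<in> Obj (cod_cat F)" and "Y \<in> Obj (cod_cat F)"
  using assms base.Dom_in_Obj base.Cod_in_Obj by (auto simp: hom_set_def)

lemma fibre_partial_order: "X \<in> Obj (cod_cat F) \<Longrightarrow> partial_order (fibre F X)"
  using complete complete_lattice.axioms(1) by blast

lemma fibre_refl:
  assumes "X \<in> Obj (cod_cat F)" and "A \<in> carrier (fibre F X)"
  shows "le (fibre F X) A A"
proof -
  interpret partial_order "fibre F X" using assms(1) by (rule fibre_partial_order)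
  show ?thesis using assms(2) by (rule le_refl)
qed

lemma fibre_trans:
  assumes "X \<in> Obj (cod_cat F)"
    and "A \<in> carrier (fibre F X)" "B \<in> carrier (fibre F X)" "D \<in> carrier (fibre F X)"
    and "le (fibre F X) A B" "le (fibre F X) B D"
  shows "le (fibre F X) A D"
proof -
  interpret partial_order "fibre F X" using assms(1) by (rule fibre_partial_order)
  show ?thesis using assms(2-) le_trans by blast
qed

lemma fibre_antisym:
  assumes "X \<in> Obj (cod_cat F)"
    and "A \<in> carrier (fibre F X)" "B \<in> carrier (fibre F X)"
    and "le (fibre F X) A B" "le (fibre F X) B A"
  shows "A = B"
proof -
  interpret partial_order "fibre F X" using assms(1) by (rule fibre_partial_order)
  show ?thesis using assms(2-) le_antisym by blast
qed


section \<open>Direct and inverse images\<close>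

text \<open>
  The universal property of a direct image, restricted to the fibre over the codomain: take the
  second morphism to be an identity.
\<close>

lemma is_direct_image_le_iff:
  assumes "f \<in> hom_set (cod_cat F) X Y" and "is_direct_image F f A E"
    and "B \<in> carrier (fibre F Y)"
  shows "le (fibre F Y) E B \<longleftrightarrow> leq_over F f A B"
proof -
  have "Cod (cod_cat F) f = Y"
    using assms(1) by (simp add: hom_set_def)
  moreover have "Ident (cod_cat F) Y \<in> hom_set (cod_cat F) Y Y"
    using hom_set_objects(2)[OF assms(1)] by (rule base.Ident_hom)
  ultimately show ?thesis
    using assms(2,3) base.Comp_Ident_left[OF assms(1)]
    by (auto simp: is_direct_image_def carrier_fibre_iff le_fibre)
qed

lemma is_inverse_image_le_iff:
  assumes "f \<in> hom_set (cod_cat F) X Y" and "is_inverse_image F B f E"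
    and "A \<in> carrier (fibre F X)"
  shows "le (fibre F X) A E \<longleftrightarrow> leq_over F f A B"
proof -
  have "Dom (cod_cat F) f = X"
    using assms(1) by (simp add: hom_set_def)
  moreover have "Ident (cod_cat F) X \<in> hom_set (cod_cat F) X X"
    using hom_set_objects(1)[OF assms(1)] by (rule base.Ident_hom)
  ultimately show ?thesis
    using assms(2,3) base.Comp_Ident_right[OF assms(1)]
    by (auto simp: is_inverse_image_def carrier_fibre_iff le_fibre)
qed

lemma is_direct_image_direct_image:
  assumes f: "f \<in> hom_set (cod_cat F) X Y" and A: "A \<in> carrier (fibre F X)"
  shows "is_direct_image F f A (direct_image F f A)"
proof -
  obtain E where E: "is_direct_image F f A E"
    using images f A unfolding has_images_def by blast
  have "E' = E" if E': "is_direct_image F f A E'" for E'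
  proof (rule fibre_antisym[OF hom_set_objects(2)[OF f]])
    show "E' \<in> carrier (fibre F Y)" "E \<in> carrier (fibre F Y)"
      using E E' f by (auto simp: is_direct_image_def hom_set_def)
    then show "le (fibre F Y) E' E" "le (fibre F Y) E E'"
      using E E' is_direct_image_le_iff[OF f] by (auto simp: is_direct_image_def)
  qed
  with E show ?thesis
    unfolding direct_image_def by (rule theI)
qed

lemma is_inverse_image_inverse_image:
  assumes f: "f \<in> hom_set (cod_cat F) X Y" and B: "B \<in> carrier (fibre F Y)"
  shows "is_inverse_image F B f (inverse_image F B f)"
proof -
  obtain E where E: "is_inverse_image F B f E"
    using images f B unfolding has_images_def by blast
  have "E' = E" if E': "is_inverse_image F B f E'" for E'
  proof (rule fibre_antisym[OF hom_set_objects(1)[OF f]])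
    show "E' \<in> carrier (fibre F X)" "E \<in> carrier (fibre F X)"
      using E E' f by (auto simp: is_inverse_image_def hom_set_def)
    then show "le (fibre F X) E' E" "le (fibre F X) E E'"
      using E E' is_inverse_image_le_iff[OF f] by (auto simp: is_inverse_image_def)
  qed
  with E show ?thesis
    unfolding inverse_image_def by (rule theI)
qed

lemma direct_image_closed:
  assumes "f \<in> hom_set (cod_cat F) X Y" and "A \<in> carrier (fibre F X)"
  shows "direct_image F f A \<in> carrier (fibre F Y)"
  using is_direct_image_direct_image[OF assms] assms(1) by (simp add: is_direct_image_def hom_set_def)

lemma inverse_image_closed:
  assumes "f \<in> hom_set (cod_cat F) X Y" and "B \<in> carrier (fibre F Y)"
  shows "inverse_image F B f \<in> carrier (fibre F X)"
  using is_inverse_image_inverse_image[OF assms] assms(1) by (simp add: is_inverse_image_def hom_set_def)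

lemma direct_image_le_iff:
  assumes "f \<in> hom_set (cod_cat F) X Y" and "A \<in> carrier (fibre F X)" and "B \<in> carrier (fibre F Y)"
  shows "le (fibre F Y) (direct_image F f A) B \<longleftrightarrow> leq_over F f A B"
  using is_direct_image_le_iff is_direct_image_direct_image assms by blast

lemma le_inverse_image_iff:
  assumes "f \<in> hom_set (cod_cat F) X Y" and "A \<in> carrier (fibre F X)" and "B \<in> carrier (fibre F Y)"
  shows "le (fibre F X) A (inverse_image F B f) \<longleftrightarrow> leq_over F f A B"
  using is_inverse_image_le_iff is_inverse_image_inverse_image assms by blast

lemma leq_over_direct_image:
  assumes "f \<in> hom_set (cod_cat F) X Y" and "A \<in> carrier (fibre F X)"
  shows "leq_over F f A (direct_image F f A)"
  using is_direct_image_direct_image[OF assms] by (simp add: is_direct_image_def)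


section \<open>From closure operators to topogenous orders\<close>

lemma closure_op_closed:
  "closure_op F C \<Longrightarrow> X \<in> Obj (cod_cat F) \<Longrightarrow> A \<in> carrier (fibre F X) \<Longrightarrow>
    C X A \<in> carrier (fibre F X)"
  unfolding closure_op_def by (blast dest: PiE_mem)

lemma closure_op_extensive:
  "closure_op F C \<Longrightarrow> X \<in> Obj (cod_cat F) \<Longrightarrow> A \<in> carrier (fibre F X) \<Longrightarrow>
    le (fibre F X) A (C X A)"
  unfolding closure_op_def by blast

lemma closure_op_leq_over:
  "closure_op F C \<Longrightarrow> f \<in> hom_set (cod_cat F) X Y \<Longrightarrow> A \<in> carrier (fibre F X) \<Longrightarrow>
    B \<in> carrier (fibre F Y) \<Longrightarrow> leq_over F f A B \<Longrightarrow> leq_over F f (C X A) (C Y B)"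
  unfolding closure_op_def by blast

lemma closure_op_mono:
  assumes "closure_op F C" and "X \<in> Obj (cod_cat F)"
    and "A \<in> carrier (fibre F X)" "B \<in> carrier (fibre F X)" and "le (fibre F X) A B"
  shows "le (fibre F X) (C X A) (C X B)"
  using closure_op_leq_over[OF assms(1) base.Ident_hom] assms(2-) by (simp add: le_fibre)

lemma mem_topo_of_clo_iff:
  "(A, B) \<in> topo_of_clo F C X \<longleftrightarrow> X \<in> Obj (cod_cat F) \<and> A \<in> carrier (fibre F X) \<and>
     B \<in> carrier (fibre F X) \<and> le (fibre F X) (C X A) B"
  by (simp add: topo_of_clo_def)

lemma topogenous_topo_of_clo:
  assumes C: "closure_op F C"
  shows "topogenous F (topo_of_clo F C)"
  unfolding topogenous_def
proof (intro conjI allI ballI impI)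
  fix X assume "X \<in> Obj (cod_cat F)"
  then show "topo_of_clo F C X \<subseteq> carrier (fibre F X) \<times> carrier (fibre F X)"
    by (auto simp: topo_of_clo_def)
next
  fix X assume "X \<notin> Obj (cod_cat F)"
  then show "topo_of_clo F C X = {}"
    by (simp add: topo_of_clo_def)
next
  fix X p assume X: "X \<in> Obj (cod_cat F)" and "p \<in> topo_of_clo F C X"
  then show "case p of (A, B) \<Rightarrow> le (fibre F X) A B"
    using fibre_trans[OF X] closure_op_closed[OF C X] closure_op_extensive[OF C X]
    unfolding topo_of_clo_def by blast
next
  fix X A' B' p
  assume X: "X \<in> Obj (cod_cat F)"
    and A': "A' \<in> carrier (fibre F X)" and B': "B' \<in> carrier (fibre F X)"
    and p: "p \<in> topo_of_clo F C X"
  show "case p of (A, B) \<Rightarrow> le (fibre F X) A' A \<and> le (fibre F X) B B' \<longrightarrow>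
      (A', B') \<in> topo_of_clo F C X"
  proof (rule case_prodI2, rule impI, elim conjE)
    fix A B assume "p = (A, B)" and le: "le (fibre F X) A' A" "le (fibre F X) B B'"
    with p have A: "A \<in> carrier (fibre F X)" and B: "B \<in> carrier (fibre F X)"
      and CAB: "le (fibre F X) (C X A) B"
      by (auto simp: mem_topo_of_clo_iff)
    note closed = closure_op_closed[OF C X]
    have "le (fibre F X) (C X A') (C X A)"
      using closure_op_mono[OF C X A' A le(1)] .
    then have "le (fibre F X) (C X A') B"
      using fibre_trans[OF X closed[OF A'] closed[OF A] B] CAB by blast
    then have "le (fibre F X) (C X A') B'"
      using fibre_trans[OF X closed[OF A'] B B'] le(2) by blast
    with X A' B' show "(A', B') \<in> topo_of_clo F C X"
      by (simp add: mem_topo_of_clo_iff)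
  qed
next
  fix X Y f A B
  assume f: "f \<in> hom_set (cod_cat F) X Y"
    and A: "A \<in> carrier (fibre F X)" and B: "B \<in> carrier (fibre F Y)"
    and "(direct_image F f A, B) \<in> topo_of_clo F C Y"
  then have le: "le (fibre F Y) (C Y (direct_image F f A)) B"
    by (simp add: mem_topo_of_clo_iff)
  note X = hom_set_objects(1)[OF f]
  have "leq_over F f (C X A) (C Y (direct_image F f A))"
    using closure_op_leq_over[OF C f A] direct_image_closed[OF f A] leq_over_direct_image[OF f A]
    by blast
  then have "leq_over F f (C X A) B"
    using leq_over_le_trans[OF f] le by blast
  then have "le (fibre F X) (C X A) (inverse_image F B f)"
    using le_inverse_image_iff[OF f closure_op_closed[OF C X A] B] by blast
  then show "(A, inverse_image F B f) \<in> topo_of_clo F C X"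
    using X A inverse_image_closed[OF f B] by (simp add: mem_topo_of_clo_iff)
qed

text \<open>Being above the fixed element \<open>C X A\<close> is preserved by every meet that exists.\<close>

lemma TM_topo_of_clo:
  assumes C: "closure_op F C"
  shows "TM F (topo_of_clo F C)"
  unfolding TM_def
proof (intro ballI allI impI)
  fix X A S M
  assume X: "X \<in> Obj (cod_cat F)" and A: "A \<in> carrier (fibre F X)"
    and S: "S \<subseteq> carrier (fibre F X)"
    and "(\<forall>B\<in>S. (A, B) \<in> topo_of_clo F C X) \<and> is_glb (fibre F X) M S"
  then have rel: "\<And>B. B \<in> S \<Longrightarrow> le (fibre F X) (C X A) B" and M: "is_glb (fibre F X) M S"
    by (auto simp: mem_topo_of_clo_iff)
  have "C X A \<in> Lower (fibre F X) S"
    using rel closure_op_closed[OF C X A] S by (auto intro: Lower_memI)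
  then have "le (fibre F X) (C X A) M"
    using M greatest_le by fast
  then show "(A, M) \<in> topo_of_clo F C X"
    using X A greatest_closed[OF M] by (simp add: mem_topo_of_clo_iff)
qed


section \<open>From topogenous orders to closure operators\<close>

lemma topogenous_carrier:
  assumes "topogenous F R" and "(A, B) \<in> R X"
  shows "X \<in> Obj (cod_cat F)" "A \<in> carrier (fibre F X)" "B \<in> carrier (fibre F X)"
  using assms unfolding topogenous_def by blast+

lemma topogenous_le:
  assumes "topogenous F R" and "(A, B) \<in> R X"
  shows "le (fibre F X) A B"
proof -
  have "\<forall>(A, B) \<in> R X. le (fibre F X) A B"
    using assms(1) topogenous_carrier(1)[OF assms] by (simp add: topogenous_def)
  with assms(2) show ?thesis by blast
qed

lemma topogenous_weaken:
  assumes "topogenous F R" and "(A, B) \<in> R X"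
    and "A' \<in> carrier (fibre F X)" "B' \<in> carrier (fibre F X)"
    and "le (fibre F X) A' A" "le (fibre F X) B B'"
  shows "(A', B') \<in> R X"
proof -
  have "\<forall>A' \<in> carrier (fibre F X). \<forall>B' \<in> carrier (fibre F X). \<forall>(A, B) \<in> R X.
      le (fibre F X) A' A \<and> le (fibre F X) B B' \<longrightarrow> (A', B') \<in> R X"
    using assms(1) topogenous_carrier(1)[OF assms(1,2)] by (simp add: topogenous_def)
  with assms(2-) show ?thesis by blast
qed

lemma topogenous_images:
  assumes "topogenous F R" and "f \<in> hom_set (cod_cat F) X Y"
    and "A \<in> carrier (fibre F X)" "B \<in> carrier (fibre F Y)"
    and "(direct_image F f A, B) \<in> R Y"
  shows "(A, inverse_image F B f) \<in> R X"
  using assms unfolding topogenous_def by blast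

lemma clo_of_topo_glb:
  assumes X: "X \<in> Obj (cod_cat F)" and A: "A \<in> carrier (fibre F X)"
  shows "is_glb (fibre F X) (clo_of_topo F R X A) {B \<in> carrier (fibre F X). (A, B) \<in> R X}"
proof -
  interpret complete_lattice "fibre F X" using X by (rule complete)
  show ?thesis
    using X A by (simp add: clo_of_topo_def inf_glb)
qed

lemma clo_of_topo_closed:
  assumes "X \<in> Obj (cod_cat F)" and "A \<in> carrier (fibre F X)"
  shows "clo_of_topo F R X A \<in> carrier (fibre F X)"
  using clo_of_topo_glb[OF assms] by (rule greatest_closed)

text \<open>(TM), applied to the family of all \<open>B\<close> related to \<open>A\<close>: the meet defining \<open>C\<^sup>\<sqsubset> A\<close> is attained.\<close>

lemma related_clo_of_topo:
  assumes "TM F R" and X: "X \<in> Obj (cod_cat F)" and A: "A \<in> carrier (fibre F X)"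
  shows "(A, clo_of_topo F R X A) \<in> R X"
proof -
  let ?S = "{B \<in> carrier (fibre F X). (A, B) \<in> R X}"
  have "?S \<subseteq> carrier (fibre F X)" and "\<forall>B\<in>?S. (A, B) \<in> R X" by auto
  then show ?thesis
    using assms(1) X A clo_of_topo_glb[OF X A, of R] unfolding TM_def by blast
qed

lemma related_iff_clo_of_topo_le:
  assumes R: "topogenous F R" "TM F R" and X: "X \<in> Obj (cod_cat F)"
    and A: "A \<in> carrier (fibre F X)" and B: "B \<in> carrier (fibre F X)"
  shows "(A, B) \<in> R X \<longleftrightarrow> le (fibre F X) (clo_of_topo F R X A) B"
proof
  assume "(A, B) \<in> R X"
  with B show "le (fibre F X) (clo_of_topo F R X A) B"
    using greatest_Lower_below[OF clo_of_topo_glb[OF X A, of R]] by blast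
next
  assume "le (fibre F X) (clo_of_topo F R X A) B"
  then show "(A, B) \<in> R X"
    using topogenous_weaken[OF R(1) related_clo_of_topo[OF R(2) X A] A B fibre_refl[OF X A]] by blast
qed

lemma closure_op_clo_of_topo:
  assumes R: "topogenous F R" "TM F R"
  shows "closure_op F (clo_of_topo F R)"
  unfolding closure_op_def
proof (intro conjI allI ballI impI)
  show "clo_of_topo F R \<in> (\<Pi>\<^sub>E X \<in> Obj (cod_cat F). carrier (fibre F X) \<rightarrow>\<^sub>E carrier (fibre F X))"
  proof (rule PiE_I)
    fix X assume X: "X \<in> Obj (cod_cat F)"
    show "clo_of_topo F R X \<in> carrier (fibre F X) \<rightarrow>\<^sub>E carrier (fibre F X)"
      by (rule PiE_I) (simp_all add: clo_of_topo_closed[OF X], simp add: clo_of_topo_def X)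
  qed (simp add: clo_of_topo_def)
next
  fix X A assume "X \<in> Obj (cod_cat F)" and "A \<in> carrier (fibre F X)"
  then show "le (fibre F X) A (clo_of_topo F R X A)"
    using topogenous_le[OF R(1) related_clo_of_topo[OF R(2)]] by blast
next
  fix X Y f A B
  assume f: "f \<in> hom_set (cod_cat F) X Y"
    and A: "A \<in> carrier (fibre F X)" and B: "B \<in> carrier (fibre F Y)"
    and AB: "leq_over F f A B"
  let ?C = "clo_of_topo F R"
  note X = hom_set_objects(1)[OF f] and Y = hom_set_objects(2)[OF f]
  note CA = clo_of_topo_closed[OF X A, of R] and CB = clo_of_topo_closed[OF Y B, of R]
  have "le (fibre F Y) (direct_image F f A) B"
    using AB direct_image_le_iff[OF f A B] by blast
  then have "(direct_image F f A, ?C Y B) \<in> R Y"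
    using topogenous_weaken[OF R(1) related_clo_of_topo[OF R(2) Y B]
        direct_image_closed[OF f A] CB] fibre_refl[OF Y CB] by blast
  then have "(A, inverse_image F (?C Y B) f) \<in> R X"
    by (rule topogenous_images[OF R(1) f A CB])
  then have "le (fibre F X) (?C X A) (inverse_image F (?C Y B) f)"
    using related_iff_clo_of_topo_le[OF R X A inverse_image_closed[OF f CB]] by blast
  then show "leq_over F f (?C X A) (?C Y B)"
    using le_inverse_image_iff[OF f CA CB] by blast
qed


section \<open>The two assignments are mutually inverse\<close>

lemma closure_op_eqI:
  assumes "closure_op F C" and "closure_op F C'"
    and "\<And>X A. X \<in> Obj (cod_cat F) \<Longrightarrow> A \<in> carrier (fibre F X) \<Longrightarrow> C X A = C' X A"
  shows "C = C'"
proof (rule PiE_ext)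
  show "C \<in> (\<Pi>\<^sub>E X \<in> Obj (cod_cat F). carrier (fibre F X) \<rightarrow>\<^sub>E carrier (fibre F X))"
    and "C' \<in> (\<Pi>\<^sub>E X \<in> Obj (cod_cat F). carrier (fibre F X) \<rightarrow>\<^sub>E carrier (fibre F X))"
    using assms(1,2) by (simp_all add: closure_op_def)
  fix X assume X: "X \<in> Obj (cod_cat F)"
  show "C X = C' X"
  proof (rule PiE_ext)
    show "C X \<in> carrier (fibre F X) \<rightarrow>\<^sub>E carrier (fibre F X)"
      and "C' X \<in> carrier (fibre F X) \<rightarrow>\<^sub>E carrier (fibre F X)"
      using assms(1,2) X by (auto simp: closure_op_def dest: PiE_mem)
  qed (rule assms(3)[OF X])
qed

lemma topo_of_clo_of_topo:
  assumes R: "topogenous F R" "TM F R"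
  shows "topo_of_clo F (clo_of_topo F R) = R"
proof (rule ext)
  fix X
  have "(A, B) \<in> topo_of_clo F (clo_of_topo F R) X \<longleftrightarrow> (A, B) \<in> R X" for A B
    using related_iff_clo_of_topo_le[OF R] topogenous_carrier[OF R(1)]
    unfolding mem_topo_of_clo_iff by blast
  then show "topo_of_clo F (clo_of_topo F R) X = R X" by auto
qed

lemma clo_of_topo_of_clo:
  assumes C: "closure_op F C"
  shows "clo_of_topo F (topo_of_clo F C) = C"
proof (rule closure_op_eqI)
  let ?C = "clo_of_topo F (topo_of_clo F C)"
  note R = topogenous_topo_of_clo[OF C] TM_topo_of_clo[OF C]
  show "closure_op F ?C"
    using R by (rule closure_op_clo_of_topo)
  show "closure_op F C" by (rule C)
  fix X A assume X: "X \<in> Obj (cod_cat F)" and A: "A \<in> carrier (fibre F X)"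
  note CA = closure_op_closed[OF C X A]
    and C'A = clo_of_topo_closed[OF X A, of "topo_of_clo F C"]
  \<comment> \<open>Both sides lie below the same elements of the fibre.\<close>
  have iff: "le (fibre F X) (?C X A) B \<longleftrightarrow> le (fibre F X) (C X A) B" if "B \<in> carrier (fibre F X)" for B
    using related_iff_clo_of_topo_le[OF R X A that] that X A by (simp add: mem_topo_of_clo_iff)
  show "?C X A = C X A"
    using fibre_antisym[OF X C'A CA] iff[OF CA] iff[OF C'A] fibre_refl[OF X] CA C'A by blast
qed


section \<open>The orders\<close>

lemma carrier_Clo: "C \<in> carrier (Clo F) \<longleftrightarrow> closure_op F C"
  by (simp add: Clo_def)

lemma le_Clo:
  "le (Clo F) C C' \<longleftrightarrow>
    (\<forall>X \<in> Obj (cod_cat F). \<forall>A \<in> carrier (fibre F X). le (fibre F X) (C X A) (C' X A))"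
  by (simp add: Clo_def)

lemma carrier_MTORD: "R \<in> carrier (MTORD F) \<longleftrightarrow> topogenous F R \<and> TM F R"
  by (simp add: MTORD_def)

lemma le_MTORD: "le (MTORD F) R R' \<longleftrightarrow> (\<forall>X \<in> Obj (cod_cat F). R X \<subseteq> R' X)"
  by (simp add: MTORD_def)

lemma partial_order_Clo: "partial_order (Clo F)"
proof
  show "(.=\<^bsub>Clo F\<^esub>) = (=)"
    by (simp add: Clo_def)
  fix C C' C''
  assume C: "C \<in> carrier (Clo F)"
  then show "le (Clo F) C C"
    using fibre_refl closure_op_closed unfolding carrier_Clo le_Clo by blast
  assume C': "C' \<in> carrier (Clo F)"
  {
    assume "le (Clo F) C C'" and "le (Clo F) C' C"
    with C C' have "C = C'"
      unfolding carrier_Clo le_Clo by (blast intro: closure_op_eqI fibre_antisym closure_op_closed)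
    then show "C .=\<^bsub>Clo F\<^esub> C'"
      by (simp add: Clo_def)
  }
  assume "C'' \<in> carrier (Clo F)" and "le (Clo F) C C'" and "le (Clo F) C' C''"
  with C C' show "le (Clo F) C C''"
    unfolding carrier_Clo le_Clo by (blast intro: fibre_trans closure_op_closed)
qed (auto simp: Clo_def)

lemma partial_order_MTORD: "partial_order (MTORD F)"
proof
  show "(.=\<^bsub>MTORD F\<^esub>) = (=)"
    by (simp add: MTORD_def)
  fix R R'
  assume "R \<in> carrier (MTORD F)" "R' \<in> carrier (MTORD F)" "le (MTORD F) R R'" "le (MTORD F) R' R"
  then have "R X = R' X" for X
    by (cases "X \<in> Obj (cod_cat F)") (auto simp: carrier_MTORD le_MTORD topogenous_def)
  then show "R .=\<^bsub>MTORD F\<^esub> R'"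
    by (auto simp: MTORD_def)
qed (auto simp: MTORD_def)

text \<open>To recover \<open>C \<le> C'\<close> from the inclusion, test it on the pairs \<open>(A, C' X A)\<close>.\<close>

lemma topo_of_clo_antitone_iff:
  assumes C: "closure_op F C" and C': "closure_op F C'"
  shows "le (MTORD F) (topo_of_clo F C') (topo_of_clo F C) \<longleftrightarrow> le (Clo F) C C'"
proof
  assume le: "le (MTORD F) (topo_of_clo F C') (topo_of_clo F C)"
  show "le (Clo F) C C'"
    unfolding le_Clo
  proof (intro ballI)
    fix X A assume X: "X \<in> Obj (cod_cat F)" and A: "A \<in> carrier (fibre F X)"
    have "(A, C' X A) \<in> topo_of_clo F C' X"
      using X A closure_op_closed[OF C' X A] fibre_refl[OF X] by (simp add: mem_topo_of_clo_iff)
    with le X have "(A, C' X A) \<in> topo_of_clo F C X"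
      by (auto simp: le_MTORD)
    then show "le (fibre F X) (C X A) (C' X A)"
      by (simp add: mem_topo_of_clo_iff)
  qed
next
  assume le: "le (Clo F) C C'"
  have "(A, B) \<in> topo_of_clo F C X" if "(A, B) \<in> topo_of_clo F C' X" for X A B
  proof -
    have X: "X \<in> Obj (cod_cat F)" and A: "A \<in> carrier (fibre F X)"
      and B: "B \<in> carrier (fibre F X)" and C'A: "le (fibre F X) (C' X A) B"
      using that by (simp_all add: mem_topo_of_clo_iff)
    have "le (fibre F X) (C X A) (C' X A)"
      using le X A by (simp add: le_Clo)
    then have "le (fibre F X) (C X A) B"
      using fibre_trans[OF X closure_op_closed[OF C X A] closure_op_closed[OF C' X A] B] C'A by blast
    then show ?thesis
      using X A B by (simp add: mem_topo_of_clo_iff)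
  qed
  then show "le (MTORD F) (topo_of_clo F C') (topo_of_clo F C)"
    by (auto simp: le_MTORD)
qed


section \<open>Idempotence and interpolation\<close>

lemma idempotent_op_iff_interpolative:
  assumes C: "closure_op F C"
  shows "idempotent_op F C \<longleftrightarrow> interpolative F (topo_of_clo F C)"
proof
  assume idem: "idempotent_op F C"
  show "interpolative F (topo_of_clo F C)"
    unfolding interpolative_def
  proof (intro ballI, clarify)
    fix X A B assume X: "X \<in> Obj (cod_cat F)" and AB: "(A, B) \<in> topo_of_clo F C X"
    then have A: "A \<in> carrier (fibre F X)"
      by (simp add: mem_topo_of_clo_iff)
    note CA = closure_op_closed[OF C X A]
    have "C X (C X A) = C X A"
      using idem X A by (simp add: idempotent_op_def idempotent_def eq_fibre)
    then have "(A, C X A) \<in> topo_of_clo F C X \<and> (C X A, B) \<in> topo_of_clo F C X"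
      using AB CA fibre_refl[OF X CA] by (simp add: mem_topo_of_clo_iff)
    with CA show "\<exists>D\<in>carrier (fibre F X). (A, D) \<in> topo_of_clo F C X \<and> (D, B) \<in> topo_of_clo F C X"
      by blast
  qed
next
  assume interp: "interpolative F (topo_of_clo F C)"
  show "idempotent_op F C"
    unfolding idempotent_op_def idempotent_def eq_fibre
  proof (intro ballI)
    fix X A assume X: "X \<in> Obj (cod_cat F)" and A: "A \<in> carrier (fibre F X)"
    note closed = closure_op_closed[OF C X]
    note CA = closed[OF A]
    note CCA = closed[OF CA]
    have "(A, C X A) \<in> topo_of_clo F C X"
      using X A CA fibre_refl[OF X CA] by (simp add: mem_topo_of_clo_iff)
    then obtain D where "(A, D) \<in> topo_of_clo F C X" and "(D, C X A) \<in> topo_of_clo F C X"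
      using interp X unfolding interpolative_def by blast
    then have D: "D \<in> carrier (fibre F X)"
      and CAD: "le (fibre F X) (C X A) D" and CDCA: "le (fibre F X) (C X D) (C X A)"
      by (simp_all add: mem_topo_of_clo_iff)
    have "le (fibre F X) (C X (C X A)) (C X A)"
      using fibre_trans[OF X CCA closed[OF D] CA] closure_op_mono[OF C X CA D CAD] CDCA by blast
    then show "C X (C X A) = C X A"
      using fibre_antisym[OF X CCA CA] closure_op_extensive[OF C X CA] by blast
  qed
qed

end

text \<open>
  The inverse of a bijective order embedding is one too, so that a single equivalence settles both
  directions.
\<close>

lemma inverse_order_isosI:
  assumes P: "partial_order P" and Q: "partial_order Q"
    and f: "f \<in> carrier P \<rightarrow> carrier Q" and g: "g \<in> carrier Q \<rightarrow> carrier P"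
    and gf: "\<And>p. p \<in> carrier P \<Longrightarrow> g (f p) = p" and fg: "\<And>q. q \<in> carrier Q \<Longrightarrow> f (g q) = q"
    and le_iff: "\<And>p p'. p \<in> carrier P \<Longrightarrow> p' \<in> carrier P \<Longrightarrow> le Q (f p) (f p') \<longleftrightarrow> le P p p'"
  shows "inverse_order_isos P Q f g"
proof -
  have weak: "weak_partial_order P" "weak_partial_order Q"
    using P Q partial_order.axioms(1) by blast+
  have "le P (g q) (g q') \<longleftrightarrow> le Q q q'" if "q \<in> carrier Q" "q' \<in> carrier Q" for q q'
    using le_iff[of "g q" "g q'"] fg g that by auto
  then show ?thesis
    unfolding inverse_order_isos_def order_emb_def
    using P Q weak f g gf fg le_iff by blast
qed

theorem proposition3p2:
  fixes F :: "('a, 'm, 'x, 'n) funct"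
  assumes "form F"
    and "has_images F"
    and "\<And>X. X \<in> Obj (cod_cat F) \<Longrightarrow> complete_lattice (fibre F X)"
  shows "inverse_order_isos (Clo F) (inv_gorder (MTORD F)) (topo_of_clo F) (clo_of_topo F) \<and>
    (\<forall>R \<in> carrier (MTORD F). idempotent_op F (clo_of_topo F R) \<longleftrightarrow> interpolative F R)"
proof (intro conjI ballI)
  interpret complete_form F
    using assms by (simp add: complete_form_def complete_form_axioms_def)
  show "inverse_order_isos (Clo F) (inv_gorder (MTORD F)) (topo_of_clo F) (clo_of_topo F)"
  proof (rule inverse_order_isosI)
    show "partial_order (Clo F)"
      by (rule partial_order_Clo)
    show "partial_order (inv_gorder (MTORD F))"
      using partial_order_MTORD by (rule partial_order.dual_order)
    show "topo_of_clo F \<in> carrier (Clo F) \<rightarrow> carrier (inv_gorder (MTORD F))"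
      by (auto simp: carrier_Clo carrier_MTORD topogenous_topo_of_clo TM_topo_of_clo)
    show "clo_of_topo F \<in> carrier (inv_gorder (MTORD F)) \<rightarrow> carrier (Clo F)"
      by (auto simp: carrier_Clo carrier_MTORD closure_op_clo_of_topo)
  qed (auto simp: carrier_Clo carrier_MTORD clo_of_topo_of_clo topo_of_clo_of_topo
      topo_of_clo_antitone_iff)
  fix R assume "R \<in> carrier (MTORD F)"
  then have R: "topogenous F R" "TM F R"
    by (simp_all add: carrier_MTORD)
  show "idempotent_op F (clo_of_topo F R) \<longleftrightarrow> interpolative F R"
    using idempotent_op_iff_interpolative[OF closure_op_clo_of_topo[OF R]]
    by (simp add: topo_of_clo_of_topo[OF R])
qed

end
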